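(* Let $n\ge 1$ and $\pi\in S_n$. Then $\mathbf{PSB}(\pi)=id_n$ if and only if $\pi\in \mathrm{Av}_n(231,4213)$.
   Context: $S_n$ is the set of permutations of $\{1,\dots,n\}$ in one-line notation, and $id_n=12\cdots n$. $\mathrm{Av}_n(T)$ is the set of permutations in $S_n$ avoiding (in the classical sense) every pattern in $T$. The map $\mathbf{PSB}$: given an input permutation $\pi=\pi_1\cdots\pi_n$, a pop stack $S$ (initially empty) is used. For $i=1,\dots,n$ in order: (1) if $S$ is empty or $\pi_i=\mathrm{TOP}(S)-1$, where $\mathrm{TOP}(S)$ is the current top element of $S$, push $\pi_i$ on top of $S$; (2) else if $\pi_i<\mathrm{TOP}(S)-1$, bypass: append $\pi_i$ directly to the right end of the output; (3) else pop, i.e. remove all elements of $S$, appending them to the output from top to bottom, and then push $\pi_i$ into $S$. After the last entry has been processed, pop $S$ once more. The resulting output is the permutation $\mathbf{PSB}(\pi)$. *)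

theory Defs
  imports "HOL-Library.Sublist" "HOL-Combinatorics.Multiset_Permutations"
begin

text \<open>Permutations are given in one-line notation, as lists of positive natural numbers.\<close>

definition perms :: "nat \<Rightarrow> nat list set" where
  "perms n = permutations_of_set {1..n}"

definition id_perm :: "nat \<Rightarrow> nat list" where
  "id_perm n = [1..<n + 1]"

definition order_isomorphic :: "nat list \<Rightarrow> nat list \<Rightarrow> bool" where
  "order_isomorphic xs ys \<longleftrightarrow> length xs = length ys \<and>
     (\<forall>i < length xs. \<forall>j < length xs. xs ! i < xs ! j \<longleftrightarrow> ys ! i < ys ! j)"

definition contains_pattern :: "nat list \<Rightarrow> nat list \<Rightarrow> bool" where
  "contains_pattern \<pi> \<tau> \<longleftrightarrow> (\<exists>ys. subseq ys \<pi> \<and> order_isomorphic ys \<tau>)"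

definition Av :: "nat \<Rightarrow> nat list set \<Rightarrow> nat list set" where
  "Av n T = {\<pi> \<in> perms n. \<forall>\<tau> \<in> T. \<not> contains_pattern \<pi> \<tau>}"

text \<open>
  A state is a pair (stack, output). The head of the stack list is its top, so popping
  appends the whole list to the output. The comparisons of \<open>x\<close> with \<open>t - 1\<close> are written
  as \<open>x + 1 = t\<close> and \<open>x + 1 < t\<close> to avoid truncated subtraction.
\<close>

fun psb_step :: "nat list \<times> nat list \<Rightarrow> nat \<Rightarrow> nat list \<times> nat list" where
  "psb_step ([], out) x = ([x], out)"
| "psb_step (t # S, out) x =
     (if x + 1 = t then (x # t # S, out)
      else if x + 1 < t then (t # S, out @ [x])
      else ([x], out @ t # S))"

definition PSB :: "nat list \<Rightarrow> nat list" where
  "PSB \<pi> = (case foldl psb_step ([], []) \<pi> of (S, out) \<Rightarrow> out @ S)"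

end

theory Submission
  imports Defs
begin

text \<open>
  A pop stack holding \<open>t, \<dots>, m - 1\<close> (top first) behaves as if the decreasing run
  \<open>m - 1, \<dots>, t\<close> were still to be read. So one shows by induction on the remaining input
  \<open>w\<close> that what is still to be output is sorted iff \<open>rev S @ w\<close> avoids both patterns,
  provided that the remaining values form an interval \<open>{a..b}\<close>. This interval condition
  survives each step unless the output is already unsorted, and in that case a pattern is visible:
  if \<open>x \<noteq> a\<close> bypasses the top \<open>t\<close>, then \<open>a\<close> and \<open>x + 1\<close> are still to come and either
  \<open>x, x + 1, a\<close> is a 231 or \<open>t, x, a, x + 1\<close> is a 4213; if \<open>x\<close> pops \<open>t \<noteq> a\<close>, then
  \<open>t, x, a\<close> is a 231.
\<close>

section \<open>Output still to come from a given stack\<close>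

fun psb_rest :: "nat list \<Rightarrow> nat list \<Rightarrow> nat list" where
  "psb_rest S [] = S"
| "psb_rest [] (x # w) = psb_rest [x] w"
| "psb_rest (t # S) (x # w) =
     (if x + 1 = t then psb_rest (x # t # S) w
      else if x + 1 < t then x # psb_rest (t # S) w
      else (t # S) @ psb_rest [x] w)"

text \<open>The output is only ever extended on the right, and no step inspects it. Hence what is
  emitted from a state on depends on the stack and the remaining input alone;
  \<open>psb_rest\<close> is this part, and the induction need not carry the output along.\<close>

lemma foldl_psb_step:
  "(case foldl psb_step (S, out) w of (S', out') \<Rightarrow> out' @ S') = out @ psb_rest S w"
  by (induction S w arbitrary: out rule: psb_rest.induct) auto

lemma PSB_eq_psb_rest: "PSB w = psb_rest [] w"
  by (simp add: PSB_def foldl_psb_step)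

lemma mset_psb_rest: "mset (psb_rest S w) = mset S + mset w"
proof (induction S w rule: psb_rest.induct)
  case (3 t S x w)
  consider "x + 1 = t" | "x + 1 < t" | "x + 1 > t"
    by linarith
  then show ?case
    by cases (use 3 in simp_all)
qed simp_all

lemma set_psb_rest: "set (psb_rest S w) = set S \<union> set w"
  by (induction S w rule: psb_rest.induct) auto

section \<open>The two patterns as inequalities between entries\<close>

definition avoids_231_4213 :: "nat list \<Rightarrow> bool" where
  "avoids_231_4213 w \<longleftrightarrow>
     (\<forall>p q r. subseq [p, q, r] w \<longrightarrow> \<not> (r < p \<and> p < q)) \<and>
     (\<forall>p q r s. subseq [p, q, r, s] w \<longrightarrow> \<not> (r < q \<and> q < s \<and> s < p))"

lemma order_isomorphic_231:
  "order_isomorphic ys [2, 3, 1] \<longleftrightarrow> (\<exists>p q r. ys = [p, q, r] \<and> r < p \<and> p < q)"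
proof (cases "length ys = 3")
  case True
  then obtain p q r where "ys = [p, q, r]"
    by (auto simp: length_Suc_conv numeral_eq_Suc)
  then show ?thesis
    by (simp add: order_isomorphic_def All_less_Suc2) linarith
qed (auto simp: order_isomorphic_def)

lemma order_isomorphic_4213:
  "order_isomorphic ys [4, 2, 1, 3] \<longleftrightarrow>
     (\<exists>p q r s. ys = [p, q, r, s] \<and> r < q \<and> q < s \<and> s < p)"
proof (cases "length ys = 4")
  case True
  then obtain p q r s where "ys = [p, q, r, s]"
    by (auto simp: length_Suc_conv numeral_eq_Suc)
  then show ?thesis
    by (simp add: order_isomorphic_def All_less_Suc2) linarith
qed (auto simp: order_isomorphic_def)

text \<open>Avoidance is separated from membership in \<open>perms n\<close> because the induction
  deals with lists whose values form an arbitrary interval.\<close>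

lemma Av_231_4213_iff:
  "w \<in> Av n {[2, 3, 1], [4, 2, 1, 3]} \<longleftrightarrow> w \<in> perms n \<and> avoids_231_4213 w"
proof -
  have "contains_pattern w [2, 3, 1] \<longleftrightarrow> (\<exists>p q r. subseq [p, q, r] w \<and> r < p \<and> p < q)"
    unfolding contains_pattern_def order_isomorphic_231 by blast
  moreover have "contains_pattern w [4, 2, 1, 3] \<longleftrightarrow>
      (\<exists>p q r s. subseq [p, q, r, s] w \<and> r < q \<and> q < s \<and> s < p)"
    unfolding contains_pattern_def order_isomorphic_4213 by blast
  ultimately show ?thesis
    unfolding Av_def avoids_231_4213_def by simp blast
qed

section \<open>Lists whose avoidance survives removal of a block or of a minimum\<close>

lemma avoids_subseq:
  assumes "avoids_231_4213 w" "subseq v w"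
  shows "avoids_231_4213 v"
proof -
  have "subseq l w" if "subseq l v" for l
    using that assms(2) by (rule subseq_order.order_trans)
  then show ?thesis
    using assms(1) unfolding avoids_231_4213_def by blast
qed

lemma subseq_set: "subseq u v \<Longrightarrow> set u \<subseteq> set v"
  by (induction rule: list_emb.induct) auto

lemma subseq_sorted_wrt: "subseq u v \<Longrightarrow> sorted_wrt R v \<Longrightarrow> sorted_wrt R u"
  by (induction rule: list_emb.induct) (auto dest: subseq_set)

text \<open>Neither 231 nor 4213 is decreasing, and neither splits into a proper initial block lying
  below the rest. So no occurrence can use an entry of \<open>u\<close>. This serves the popping of
  the least remaining values and, with \<open>v\<close> empty, the end of the input.\<close>

lemma avoids_append_greater:
  assumes dec: "sorted_wrt (>) u" and less: "\<forall>y \<in> set u. \<forall>z \<in> set v. y < z"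
  shows "avoids_231_4213 (u @ v) \<longleftrightarrow> avoids_231_4213 v"
proof
  assume v: "avoids_231_4213 v"
  have split: "\<exists>l1 l2. l = l1 @ l2 \<and> sorted_wrt (>) l1 \<and> (\<forall>y \<in> set l1. \<forall>z \<in> set l2. y < z)
      \<and> subseq l2 v" if l: "subseq l (u @ v)" for l
  proof -
    obtain l1 l2 where l12: "l = l1 @ l2" "subseq l1 u" "subseq l2 v"
      using l by (rule subseq_appendE)
    have "\<forall>y \<in> set l1. \<forall>z \<in> set l2. y < z"
      using subseq_set[OF l12(2)] subseq_set[OF l12(3)] less by blast
    then show ?thesis
      using l12 subseq_sorted_wrt[OF l12(2) dec] by (intro exI[of _ l1] exI[of _ l2]) simp
  qed
  show "avoids_231_4213 (u @ v)"
    unfolding avoids_231_4213_def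
  proof (intro conjI allI impI notI)
    fix p q r assume s: "subseq [p, q, r] (u @ v)" and o: "r < p \<and> p < q"
    obtain l1 l2 where l: "[p, q, r] = l1 @ l2" "sorted_wrt (>) l1"
        "\<forall>y \<in> set l1. \<forall>z \<in> set l2. y < z" "subseq l2 v"
      using split[OF s] by blast
    have "l1 = [] \<and> l2 = [p, q, r] \<or> l1 = [p] \<and> l2 = [q, r]
        \<or> l1 = [p, q] \<and> l2 = [r] \<or> l1 = [p, q, r] \<and> l2 = []"
      using l(1) by (auto simp: Cons_eq_append_conv)
    then consider "l1 = []" "l2 = [p, q, r]" | "l1 = [p]" "l2 = [q, r]"
      | "l1 = [p, q]" "l2 = [r]" | "l1 = [p, q, r]" "l2 = []"
      by argo
    then show False
    proof cases
      case 1
      then have "subseq [p, q, r] v" using l(4) by simp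
      then show False using o v unfolding avoids_231_4213_def by blast
    qed (use l(2,3) o in simp_all)
  next
    fix p q r s assume s: "subseq [p, q, r, s] (u @ v)" and o: "r < q \<and> q < s \<and> s < p"
    obtain l1 l2 where l: "[p, q, r, s] = l1 @ l2" "sorted_wrt (>) l1"
        "\<forall>y \<in> set l1. \<forall>z \<in> set l2. y < z" "subseq l2 v"
      using split[OF s] by blast
    have "l1 = [] \<and> l2 = [p, q, r, s] \<or> l1 = [p] \<and> l2 = [q, r, s] \<or> l1 = [p, q] \<and> l2 = [r, s]
        \<or> l1 = [p, q, r] \<and> l2 = [s] \<or> l1 = [p, q, r, s] \<and> l2 = []"
      using l(1) by (auto simp: Cons_eq_append_conv)
    then consider "l1 = []" "l2 = [p, q, r, s]" | "l1 = [p]" "l2 = [q, r, s]"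
      | "l1 = [p, q]" "l2 = [r, s]" | "l1 = [p, q, r]" "l2 = [s]" | "l1 = [p, q, r, s]" "l2 = []"
      by argo
    then show False
    proof cases
      case 1
      then have "subseq [p, q, r, s] v" using l(4) by simp
      then show False using o v unfolding avoids_231_4213_def by blast
    qed (use l(2,3) o in simp_all)
  qed
qed (auto intro: avoids_subseq[of "u @ v"])

text \<open>Being the minimum, \<open>x\<close> can only play the 1. In 231 the entries 2, 3 would
  then be an ascent in the decreasing \<open>u\<close>; in 4213 the entries 4, 2 would lie in
  \<open>u\<close> and the 3 in \<open>v\<close>, which \<open>gap\<close> forbids. This serves the
  bypass of the least remaining value.\<close>

lemma avoids_insert_minimum:
  assumes dec: "sorted_wrt (>) u" and min: "\<forall>y \<in> set u \<union> set v. x < y"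
    and gap: "\<forall>p \<in> set u. \<forall>q \<in> set u. \<forall>s \<in> set v. \<not> (q < s \<and> s < p)"
  shows "avoids_231_4213 (u @ x # v) \<longleftrightarrow> avoids_231_4213 (u @ v)"
proof
  assume uv: "avoids_231_4213 (u @ v)"
  have split: "subseq l (u @ v) \<or>
      (\<exists>l1 l2. l = l1 @ x # l2 \<and> sorted_wrt (>) l1 \<and> set l1 \<subseteq> set u \<and> set l2 \<subseteq> set v)"
    if l: "subseq l (u @ x # v)" for l
  proof -
    obtain l1 l2 where l12: "l = l1 @ l2" "subseq l1 u" "subseq l2 (x # v)"
      using l by (rule subseq_appendE)
    show ?thesis
    proof (cases "subseq l2 v")
      case True
      then show ?thesis using l12 by (auto intro: list_emb_append_mono)
    next
      \<comment> \<open>An embedding into \<open>x # v\<close> that is impossible in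
        \<open>v\<close> alone has to match its first entry with the inserted
        \<open>x\<close>.\<close>
      case False
      then obtain l3 where "l2 = x # l3" "subseq l3 v"
        using l12(3) by (cases l2) (auto split: if_splits)
      with l12 have "l = l1 @ x # l3" "sorted_wrt (>) l1" "set l1 \<subseteq> set u" "set l3 \<subseteq> set v"
        using subseq_sorted_wrt[OF _ dec] by (simp_all add: subseq_set)
      then show ?thesis by blast
    qed
  qed
  have not_less: "\<forall>y \<in> set u. \<not> y < x" "\<forall>y \<in> set v. \<not> y < x"
    using min by (simp_all add: less_imp_le not_less)
  show "avoids_231_4213 (u @ x # v)"
    unfolding avoids_231_4213_def
  proof (intro conjI allI impI notI)
    fix p q r assume s: "subseq [p, q, r] (u @ x # v)" and o: "r < p \<and> p < q"
    have "\<not> subseq [p, q, r] (u @ v)"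
      using uv o unfolding avoids_231_4213_def by blast
    then obtain l1 l2 where l: "[p, q, r] = l1 @ x # l2" "sorted_wrt (>) l1"
        "set l1 \<subseteq> set u" "set l2 \<subseteq> set v"
      using split[OF s] by blast
    from l(1) consider "p = x" "l2 = [q, r]" | "l1 = [p]" "q = x" | "l1 = [p, q]"
      by (auto simp: Cons_eq_append_conv)
    then show False
      by cases (use l(2-4) o not_less in auto)
  next
    fix p q r s assume s: "subseq [p, q, r, s] (u @ x # v)" and o: "r < q \<and> q < s \<and> s < p"
    have "\<not> subseq [p, q, r, s] (u @ v)"
      using uv o unfolding avoids_231_4213_def by blast
    then obtain l1 l2 where l: "[p, q, r, s] = l1 @ x # l2" "sorted_wrt (>) l1"
        "set l1 \<subseteq> set u" "set l2 \<subseteq> set v"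
      using split[OF s] by blast
    from l(1) consider "p = x" "l2 = [q, r, s]" | "q = x" "l2 = [r, s]"
      | "l1 = [p, q]" "l2 = [s]" | "l1 = [p, q, r]" "s = x"
      by (auto simp: Cons_eq_append_conv)
    then show False
    proof cases
      case 3
      then show False using l(3,4) o gap by simp
    qed (use l(2-4) o not_less in auto)
  qed
qed (rule avoids_subseq[of "u @ x # v"], auto intro: list_emb_append_mono)

section \<open>The invariant relating sorted output and avoidance\<close>

lemma subseq_two_cases:
  assumes "y \<in> set w" "z \<in> set w" "y \<noteq> z"
  shows "subseq [y, z] w \<or> subseq [z, y] w"
proof -
  obtain w1 w2 where w: "w = w1 @ y # w2"
    using assms(1) by (meson split_list)
  then have "z \<in> set w1 \<or> z \<in> set w2"
    using assms by auto
  then show ?thesis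
  proof
    assume "z \<in> set w1"
    then have "subseq ([z] @ [y]) (w1 @ y # w2)"
      by (intro list_emb_append_mono) (auto simp: subseq_singleton_left)
    then show ?thesis by (simp add: w)
  next
    assume "z \<in> set w2"
    then have "subseq ([] @ [y, z]) (w1 @ y # w2)"
      by (intro list_emb_append_mono) (auto simp: subseq_singleton_left)
    then show ?thesis by (simp add: w)
  qed
qed

text \<open>Writing the stack as \<open>[t..<m]\<close> covers the empty stack too, by
  \<open>t \<ge> m\<close>. The bound \<open>b\<close> stays fixed in the induction, while
  \<open>a\<close> grows: as long as the output can still be sorted, only the least remaining values
  are emitted.\<close>

lemma sorted_psb_rest_iff:
  assumes "S = [t..<m]" "distinct (S @ w)" "set (S @ w) = {a..b}"
  shows "sorted (psb_rest S w) \<longleftrightarrow> avoids_231_4213 (rev S @ w)"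
  using assms
proof (induction S w arbitrary: t m a rule: psb_rest.induct)
  case (1 S)
  have "avoids_231_4213 []"
    by (simp add: avoids_231_4213_def)
  \<comment> \<open>With no input left both sides are true: the stack is increasing from the top,
    and its reversal is decreasing.\<close>
  with 1 avoids_append_greater[of "rev S" "[]"] show ?case
    by (simp add: sorted_wrt_rev)
next
  case (2 x w)
  \<comment> \<open>The new stack is \<open>[x..<Suc x]\<close>, and the list tested for avoidance
    is \<open>x # w\<close> before and after.\<close>
  show ?case
    using "2.IH"[of x "Suc x" a] "2.prems" by simp
next
  case (3 s S x w)
  have "s = t \<and> t < m \<and> S = [Suc t..<m]"
    using "3.prems"(1)[symmetric] by (auto simp: upt_eq_Cons_conv)
  then have tm: "s = t" "t < m" "S = [Suc t..<m]"
    by simp_all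
  have stack: "s # S = [t..<m]" "set (s # S) = {t..<m}"
    using "3.prems"(1) arg_cong[OF "3.prems"(1), of set] by simp_all
  have dec: "sorted_wrt (>) (rev (s # S))"
    unfolding stack by (simp add: sorted_wrt_rev)
  have t_in: "subseq [t] (rev (s # S))"
    using tm(1) by (auto simp: subseq_singleton_left)
  have ran: "{t..<m} \<union> insert x (set w) = {a..b}"
    using "3.prems"(3) stack(2) by auto
  have dis: "x \<notin> {t..<m}" "{t..<m} \<inter> set w = {}" "x \<notin> set w" "distinct w"
    using "3.prems"(2) stack(2) by auto
  have at: "a \<le> t" "t \<le> b" "a \<le> x" "x \<le> b"
    using ran tm(2) by auto
  \<comment> \<open>By distinctness \<open>x\<close> misses \<open>{t..<m}\<close>, so a popping
    entry exceeds the whole stack and not only its top.\<close>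
  consider (push) "x + 1 = t" | (bypass) "x + 1 < t" | (pop) "m \<le> x"
    using dis(1) by fastforce
  then show ?case
  proof cases
    case push
    have "x # s # S = [x..<m]"
      using push stack(1) tm(2) upt_conv_Cons[of x m] by simp
    moreover have "distinct ((x # s # S) @ w)" "set ((x # s # S) @ w) = {a..b}"
      using "3.prems"(2,3) by auto
    ultimately have "sorted (psb_rest (x # s # S) w) \<longleftrightarrow> avoids_231_4213 (rev (x # s # S) @ w)"
      using "3.IH"(1) push tm(1) by blast
    \<comment> \<open>Pushing does not change the tested list: \<open>rev (x # s # S) @ w\<close>
      equals \<open>rev (s # S) @ x # w\<close>.\<close>
    then show ?thesis using push tm(1) by simp
  next
    case bypass
    have run: "psb_rest (s # S) (x # w) = x # psb_rest (s # S) w"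
      using bypass tm(1) by simp
    show ?thesis
    proof (cases "x = a")
      case True
      have rest: "set ((s # S) @ w) = {Suc a..b}"
      proof -
        have "set ((s # S) @ w) = {t..<m} \<union> set w"
          unfolding set_append stack(2) ..
        also have "\<dots> = {a..b} - {a}"
          unfolding ran[symmetric] using dis True by blast
        also have "\<dots> = {Suc a..b}"
          by auto
        finally show ?thesis .
      qed
      have "avoids_231_4213 (rev (s # S) @ x # w) \<longleftrightarrow> avoids_231_4213 (rev (s # S) @ w)"
      proof (rule avoids_insert_minimum[OF dec])
        show "\<forall>y \<in> set (rev (s # S)) \<union> set w. x < y"
        proof
          fix y assume "y \<in> set (rev (s # S)) \<union> set w"
          then have "y \<in> {Suc a..b}" unfolding rest[symmetric] by simp
          then show "x < y" using True by simp
        qed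
        \<comment> \<open>The stack has no holes: a value between two of its entries is itself on
          the stack and so cannot occur in \<open>w\<close>.\<close>
        show "\<forall>p \<in> set (rev (s # S)). \<forall>q \<in> set (rev (s # S)). \<forall>y \<in> set w. \<not> (q < y \<and> y < p)"
          unfolding set_rev stack(2)
        proof (intro ballI notI)
          fix p q y assume "p \<in> {t..<m}" "q \<in> {t..<m}" "y \<in> set w" "q < y \<and> y < p"
          then have "y \<in> {t..<m} \<inter> set w" by simp
          then show False using dis(2) by simp
        qed
      qed
      moreover have "sorted (psb_rest (s # S) w) \<longleftrightarrow> avoids_231_4213 (rev (s # S) @ w)"
        using "3.IH"(2)[OF _ _ stack(1) _ rest] bypass tm(1) "3.prems"(2) by simp
      moreover have "\<forall>y \<in> set (psb_rest (s # S) w). x \<le> y"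
        using rest True by (auto simp: set_psb_rest)
      ultimately show ?thesis
        unfolding run by simp
    next
      case False
      then have "a < x" using at by simp
      \<comment> \<open>Both values belong to the remaining interval, since
        \<open>x + 1 < t \<le> b\<close>. Both are below \<open>t\<close> and differ from
        \<open>x\<close>, so they can only be in \<open>w\<close>.\<close>
      have "a \<in> {t..<m} \<union> insert x (set w)" "Suc x \<in> {t..<m} \<union> insert x (set w)"
        unfolding ran using bypass at by simp_all
      then have in_w: "a \<in> set w" "Suc x \<in> set w"
        using bypass \<open>a < x\<close> by simp_all
      have "\<not> sorted (psb_rest (s # S) (x # w))"
        unfolding run using in_w(1) \<open>a < x\<close> by (auto simp: set_psb_rest intro!: bexI[of _ a])
      moreover have "\<not> avoids_231_4213 (rev (s # S) @ x # w)"
      proof -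
        \<comment> \<open>The order in which \<open>a\<close> and \<open>Suc x\<close> arrive
          decides whether a 231 or a 4213 appears.\<close>
        have "subseq [Suc x, a] w \<or> subseq [a, Suc x] w"
          using subseq_two_cases[of "Suc x" w a] in_w \<open>a < x\<close> by simp
        then have "subseq ([] @ [x, Suc x, a]) (rev (s # S) @ x # w) \<or>
            subseq ([t] @ [x, a, Suc x]) (rev (s # S) @ x # w)"
          using list_emb_append_mono[OF t_in, of "[x, a, Suc x]" "x # w"]
            list_emb_append_mono[OF list_emb_Nil, of "(=)" "[x, Suc x, a]" "x # w"] by auto
        then show ?thesis
          using \<open>a < x\<close> bypass unfolding avoids_231_4213_def by fastforce
      qed
      ultimately show ?thesis by blast
    qed
  next
    case pop
    have run: "psb_rest (s # S) (x # w) = (s # S) @ psb_rest [x] w"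
      using pop tm by simp
    show ?thesis
    proof (cases "t = a")
      case True
      \<comment> \<open>As \<open>t = a\<close>, the popped values form the initial segment
        \<open>{a..<m}\<close>; what is left is again an interval, with lower end
        \<open>m\<close>.\<close>
      have rest: "set ([x] @ w) = {m..b}"
      proof -
        have "set ([x] @ w) = {a..b} - {t..<m}"
          using ran dis by auto
        then show ?thesis using True tm(2) by auto
      qed
      have less: "\<forall>y \<in> set (s # S). \<forall>z \<in> set (x # w). y < z"
        using rest unfolding stack(2) by auto
      have "avoids_231_4213 (rev (s # S) @ x # w) \<longleftrightarrow> avoids_231_4213 (x # w)"
        using avoids_append_greater[OF dec] less by simp
      moreover have "sorted (psb_rest [x] w) \<longleftrightarrow> avoids_231_4213 (x # w)"
        using "3.IH"(3)[of x "Suc x" m] pop tm dis rest by simp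
      moreover have "sorted (s # S)"
        unfolding stack by simp
      moreover have "\<forall>y \<in> set (s # S). \<forall>z \<in> set (psb_rest [x] w). y \<le> z"
        using less by (auto simp: set_psb_rest less_imp_le)
      ultimately show ?thesis
        unfolding run sorted_append by blast
    next
      case False
      then have "a < t" using at by simp
      have "a \<in> {t..<m} \<union> insert x (set w)"
        unfolding ran using at by simp
      then have in_w: "a \<in> set w"
        using \<open>a < t\<close> pop tm(2) by simp
      \<comment> \<open>The top \<open>t\<close> is popped while the smaller \<open>a\<close> is
        still unread.\<close>
      have "\<not> sorted (psb_rest (s # S) (x # w))"
        unfolding run using in_w \<open>a < t\<close> tm(1) by (auto simp: sorted_append set_psb_rest intro!: bexI[of _ a])
      moreover have "subseq ([t] @ [x, a]) (rev (s # S) @ x # w)"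
        using in_w by (intro list_emb_append_mono t_in) (simp add: subseq_singleton_left)
      then have "\<not> avoids_231_4213 (rev (s # S) @ x # w)"
        using \<open>a < t\<close> pop tm(2) unfolding avoids_231_4213_def by fastforce
      ultimately show ?thesis by blast
    qed
  qed
qed

theorem proposition2p1:
  fixes n :: nat and \<pi> :: "nat list"
  assumes "n \<ge> 1" and "\<pi> \<in> perms n"
  shows "PSB \<pi> = id_perm n \<longleftrightarrow> \<pi> \<in> Av n {[2, 3, 1], [4, 2, 1, 3]}"
proof -
  have \<pi>: "set \<pi> = {1..n}" "distinct \<pi>"
    using assms(2) by (auto simp: perms_def permutations_of_set_def)
  have PSB: "mset (PSB \<pi>) = mset \<pi>"
    by (simp add: PSB_eq_psb_rest mset_psb_rest)
  have "set (PSB \<pi>) = set (id_perm n)" "distinct (PSB \<pi>)"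
    using PSB \<pi> by (auto simp: id_perm_def dest: mset_eq_setD mset_eq_imp_distinct_iff)
  \<comment> \<open>A sorted distinct list is determined by its set, so sortedness alone singles out
    the identity.\<close>
  then have "PSB \<pi> = id_perm n \<longleftrightarrow> sorted (PSB \<pi>)"
    by (metis distinct_upt id_perm_def sorted_distinct_set_unique sorted_upt)
  \<comment> \<open>The empty initial stack is \<open>[0..<0]\<close>, and the values to be read are
    \<open>{1..n}\<close>.\<close>
  also have "\<dots> \<longleftrightarrow> avoids_231_4213 \<pi>"
    using sorted_psb_rest_iff[of "[]" 0 0 \<pi> 1 n] \<pi> by (simp add: PSB_eq_psb_rest)
  finally show ?thesis
    using assms(2) Av_231_4213_iff by blast
qed

end
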